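(* Let $k > 1$ and $0 \le \delta < 1$ be real numbers. Then for all real numbers $x, y$ with $1 \le y \le x$, $$\#\Bigl\{ n \in \mathbb{Z} : x < n \le x+y,\ n \text{ is } k\text{-powered},\ p^{+}\bigl(n/\kappa(n)\bigr) \le y^{1-\delta} \Bigr\} \ \ll_k\ y^{\frac{3k+1}{4k}} + \frac{y^{1-\delta}}{\log(y+1)},$$ where the implied constant depends only on $k$ (not on $\delta$, $x$, $y$).
   Context: For a positive integer $n$, $\kappa(n) := \prod_{p \mid n} p$ (product over distinct primes dividing $n$) is the squarefree kernel of $n$. For a real number $k \ge 1$, a positive integer $n$ is called $k$-powered if $\kappa(n) \le n^{1/k}$. For an integer $m \ge 2$, $p^{+}(m)$ denotes the largest prime factor of $m$ (and $p^+(1)=1$ by convention; this case does not occur here, since for $k>1$ a $k$-powered $n\ge 2$ is not squarefree). The notation $f \ll_k g$ means $|f| \le C_k\, g$ for some constant $C_k > 0$ depending only on $k$. *)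

theory Defs
  imports Complex_Main "HOL-Computational_Algebra.Primes"
begin

definition squarefree_kernel :: "nat \<Rightarrow> nat" where
  "squarefree_kernel n = (\<Prod>p\<in>prime_factors n. p)"

definition k_powered :: "real \<Rightarrow> nat \<Rightarrow> bool" where
  "k_powered k n \<longleftrightarrow> n > 0 \<and> real (squarefree_kernel n) \<le> real n powr (1 / k)"

text \<open>
  \<open>Max\<close> is unspecified on the empty set, so the usual convention that the largest prime factor
  of \<open>1\<close> is \<open>1\<close> is built in. The value at \<open>0\<close> (also \<open>1\<close>) is junk.
\<close>

definition largest_prime_factor :: "nat \<Rightarrow> nat" where
  "largest_prime_factor m = (if prime_factors m = {} then 1 else Max (prime_factors m))"

end

theory Submission
  imports Defs "HOL-Computational_Algebra.Squarefree" "HOL-Analysis.Summation_Tests"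
begin

text \<open>
  A \<open>k\<close>-powered \<open>n\<close> has a powerful divisor (one of the form \<open>a\<^sup>2 * b\<^sup>3\<close>) whose cofactor is at most
  the kernel of \<open>n\<close>, so this divisor is at least \<open>n powr (1 - 1 / k)\<close>
  (\<open>powerful_divisor_with_cofactor_le_kernel\<close>). Put \<open>D = y powr ((1 - 1 / k) / 2)\<close>, so that
  \<open>D \<le> D\<^sup>2 \<le> y\<close>. Among the powerful divisors of \<open>n\<close> that are at least \<open>D\<close>, a minimal one cannot
  overshoot by much, since removing a prime from it leads below \<open>D\<close>: it is at most \<open>D\<^sup>2\<close>, unless it
  is the square of a prime (\<open>powerful_divisor_or_prime_square\<close>). This leaves two kinds of \<open>n\<close>.

  Either \<open>n\<close> has a powerful divisor between \<open>D\<close> and \<open>y\<close>. A divisor \<open>d \<le> y\<close> divides at most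
  \<open>2 * y / d\<close> integers in the interval, and the reciprocals of the powerful numbers from \<open>D\<close> on
  add up to \<open>O(D powr (-1/2))\<close>. So there are \<open>O(y * D powr (-1/2))\<close> such \<open>n\<close>, and this is exactly
  the first term of the bound (\<open>card_powerful_divisor_le\<close>).

  Or \<open>n\<close> is divisible by the square of a prime \<open>p\<close> with \<open>p\<^sup>2 > y\<close>. Then \<open>p\<close> divides \<open>n\<close> over its kernel,
  so \<open>p \<le> y powr (1 - \<delta>)\<close>, and each such \<open>p\<close> is responsible for at most two values of \<open>n\<close>. These
  primes are larger than the square root of \<open>y\<close>, so each contributes at least a constant times
  \<open>ln (y + 1)\<close> to \<open>\<Sum>p\<le>z. ln p\<close> with \<open>z = y powr (1 - \<delta>)\<close>; Chebyshev's bound \<open>z * ln 4\<close> for that sum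
  yields the second term, uniformly in \<open>\<delta>\<close> (\<open>card_large_prime_square_le\<close>).
\<close>

section \<open>Chebyshev's upper bound for primes\<close>

lemma prod_primes_dvd:
  fixes m :: nat
  assumes "finite A" "\<And>p. p \<in> A \<Longrightarrow> prime p" "\<And>p. p \<in> A \<Longrightarrow> p dvd m"
  shows "\<Prod>A dvd m"
  using assms
proof (induction A rule: finite_induct)
  case (insert p A)
  have "coprime p (\<Prod>A)"
  proof (rule prod_coprime_right)
    fix q assume "q \<in> A"
    with insert show "coprime p q" by (intro primes_coprime) auto
  qed
  with insert show ?case by (simp add: divides_mult)
qed simp

text \<open>
  The coefficient occurs twice in row \<open>2 * m + 1\<close>, whose sum is \<open>2 * 4 ^ m\<close>.
\<close>

lemma middle_binomial_le: "(2 * m + 1) choose m \<le> 4 ^ m"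
proof -
  have "(\<Sum>k\<in>{m, m + 1}. (2 * m + 1) choose k) \<le> (\<Sum>k\<le>2 * m + 1. (2 * m + 1) choose k)"
    by (rule sum_mono2) auto
  moreover have "(2 * m + 1) choose (m + 1) = (2 * m + 1) choose m"
    using binomial_symmetric[of m "2 * m + 1"] by simp
  moreover have "(2::nat) ^ (2 * m + 1) = 2 * 4 ^ m"
    by (simp add: power_mult)
  ultimately show ?thesis
    unfolding choose_row_sum by simp
qed

text \<open>
  Erdos's induction: for odd \<open>n = 2 * m + 1\<close>, every prime in \<open>(m + 1, n]\<close> divides the binomial
  coefficient \<open>n choose m\<close>, so together these primes contribute at most \<open>4 ^ m\<close>, while the primes up to
  \<open>m + 1\<close> contribute at most \<open>4 ^ (m + 1)\<close> by the induction hypothesis.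
\<close>

lemma primorial_le: "\<Prod>{p::nat. prime p \<and> p \<le> n} \<le> 4 ^ n"
proof (induction n rule: less_induct)
  case (less n)
  consider "n \<le> 1" | "n = 2" | "n > 2" "even n" | m where "n = 2 * m + 1" "m \<ge> 1"
  proof (cases "even n")
    case True
    then show ?thesis using that(1-3) by linarith
  next
    case False
    then obtain m where "n = 2 * m + 1" by (rule oddE)
    then show ?thesis using that(1) that(4)[of m] by linarith
  qed
  then show ?case
  proof cases
    case 1
    then have "{p::nat. prime p \<and> p \<le> n} = {}" by (auto dest: prime_ge_2_nat)
    then show ?thesis by (simp only: prod.empty) simp
  next
    case 2
    then have "{p::nat. prime p \<and> p \<le> n} = {2}"
      by (auto dest: prime_ge_2_nat intro: antisym)
    then show ?thesis using 2 by simp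
  next
    case 3
    have "\<not> prime n" using 3 primes_dvd_imp_eq two_is_prime_nat by blast
    then have "{p::nat. prime p \<and> p \<le> n} = {p. prime p \<and> p \<le> n - 1}"
      using 3 by (auto simp: le_less)
    also have "\<Prod>\<dots> \<le> 4 ^ (n - 1)" using 3 by (intro less) simp
    also have "\<dots> \<le> 4 ^ n" by (intro power_increasing) auto
    finally show ?thesis .
  next
    case (4 m)
    let ?A = "{p::nat. prime p \<and> p \<le> m + 1}"
    let ?B = "{p::nat. prime p \<and> m + 1 < p \<and> p \<le> 2 * m + 1}"
    have split: "{p::nat. prime p \<and> p \<le> n} = ?A \<union> ?B" using 4 by auto
    have "\<Prod>?B dvd (2 * m + 1) choose m"
    proof (rule prod_primes_dvd)
      fix p assume "p \<in> ?B"
      then have p: "prime p" "m + 1 < p" "p \<le> 2 * m + 1" by auto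
      have "fact m * fact (m + 1) * ((2 * m + 1) choose m) = (fact (2 * m + 1) :: nat)"
        using binomial_fact_lemma[of m "2 * m + 1"] by simp
      moreover have "p dvd fact (2 * m + 1)" "\<not> p dvd fact m" "\<not> p dvd fact (m + 1)"
        unfolding prime_dvd_fact_iff[OF p(1)] using p by auto
      ultimately show "p dvd (2 * m + 1) choose m"
        using p(1) by (metis prime_dvd_mult_iff)
    qed auto
    then have "\<Prod>?B \<le> (2 * m + 1) choose m"
      by (rule dvd_imp_le) simp
    also have "\<dots> \<le> 4 ^ m" by (rule middle_binomial_le)
    finally have B: "\<Prod>?B \<le> 4 ^ m" .
    have A: "\<Prod>?A \<le> 4 ^ (m + 1)" using 4 by (intro less) simp
    have "\<Prod>{p::nat. prime p \<and> p \<le> n} = \<Prod>?A * \<Prod>?B"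
      unfolding split by (rule prod.union_disjoint) auto
    also have "\<dots> \<le> 4 ^ (m + 1) * 4 ^ m" using A B by (rule mult_le_mono)
    also have "\<dots> = 4 ^ n" using 4 by (simp add: power_add[symmetric] mult_2)
    finally show ?thesis .
  qed
qed

lemma sum_ln_primes_le:
  assumes "z \<ge> 0"
  shows "(\<Sum>p | prime p \<and> real p \<le> z. ln (real p)) \<le> z * ln 4"
proof -
  define N where "N = nat \<lfloor>z\<rfloor>"
  have eq: "{p::nat. prime p \<and> real p \<le> z} = {p. prime p \<and> p \<le> N}"
    using assms unfolding N_def by (auto simp: le_nat_floor le_nat_iff le_floor_iff)
  let ?P = "{p::nat. prime p \<and> p \<le> N}"
  have "(\<Sum>p\<in>?P. ln (real p)) = ln (real (\<Prod>?P))"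
    unfolding of_nat_prod by (subst ln_prod) (auto simp: prime_gt_0_nat)
  also have "\<dots> \<le> ln (4 ^ N)"
  proof (subst ln_le_cancel_iff)
    show "real (\<Prod>?P) \<le> 4 ^ N"
      using primorial_le[of N] by (metis of_nat_le_iff of_nat_numeral of_nat_power)
    show "0 < real (\<Prod>?P)" by (auto intro!: prod_pos simp: prime_gt_0_nat)
  qed auto
  also have "\<dots> = real N * ln 4" by (simp add: ln_realpow)
  also have "\<dots> \<le> z * ln 4"
    using assms by (intro mult_right_mono) (auto simp: N_def)
  finally show ?thesis unfolding eq .
qed

text \<open>
  Counting only primes above the square root of \<open>y\<close> means that all the logarithms in Chebyshev's sum
  have the order of \<open>ln y\<close>. Comparing with \<open>ln (y + 1)\<close> instead of \<open>ln y\<close> costs one more factor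
  \<open>p\<close> (\<open>y + 1 \<le> p\<^sup>3\<close>, whence the \<open>3\<close>), and keeps the bound valid down to \<open>y = 1\<close>.
\<close>

lemma card_primes_above_sqrt_le:
  assumes "y \<ge> 1" "z \<ge> 0"
  shows "real (card {p. prime p \<and> y < real p ^ 2 \<and> real p \<le> z}) * ln (y + 1) \<le> 3 * ln 4 * z"
proof -
  let ?P = "{p::nat. prime p \<and> real p \<le> z}"
  let ?Q = "{p::nat. prime p \<and> y < real p ^ 2 \<and> real p \<le> z}"
  have fin: "finite ?P"
    by (rule finite_subset[of _ "{..nat \<lfloor>z\<rfloor>}"]) (auto simp: le_nat_floor)
  have "ln (y + 1) \<le> 3 * ln (real p)" if "p \<in> ?Q" for p
  proof -
    have p: "real p \<ge> 2" "y < real p ^ 2" using that prime_ge_2_nat by fastforce+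
    have "2 * real p ^ 2 \<le> real p * real p ^ 2" "2 * 2 \<le> real p ^ 2"
      using p mult_mono[of 2 "real p" 2 "real p"]
      by (auto simp: power2_eq_square intro!: mult_right_mono)
    then have "y + 1 \<le> real p * real p ^ 2" using p(2) by linarith
    then have "y + 1 \<le> real p ^ 3" by (simp add: power3_eq_cube power2_eq_square)
    then have "ln (y + 1) \<le> ln (real p ^ 3)" using assms by (intro ln_mono) auto
    then show ?thesis using p by (simp add: ln_realpow)
  qed
  then have "(\<Sum>p\<in>?Q. ln (y + 1)) \<le> (\<Sum>p\<in>?Q. 3 * ln (real p))" by (rule sum_mono)
  also have "\<dots> \<le> (\<Sum>p\<in>?P. 3 * ln (real p))"
    using fin by (intro sum_mono2) (auto simp: Suc_le_eq prime_gt_0_nat)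
  also have "\<dots> = 3 * (\<Sum>p\<in>?P. ln (real p))" by (simp add: sum_distrib_left)
  also have "\<dots> \<le> 3 * (z * ln 4)" using sum_ln_primes_le[OF assms(2)] by simp
  finally show ?thesis by (simp add: mult_ac)
qed

section \<open>The squarefree kernel\<close>

lemma squarefree_kernel_pos: "squarefree_kernel n > 0"
  unfolding squarefree_kernel_def
  by (auto intro!: prod_pos simp: in_prime_factors_iff prime_gt_0_nat)

lemma squarefree_kernel_dvd: "squarefree_kernel n dvd n"
  unfolding squarefree_kernel_def
  by (rule prod_primes_dvd) auto

lemma squarefree_squarefree_kernel: "squarefree (squarefree_kernel n)"
  unfolding squarefree_kernel_def
  by (rule squarefree_prod_coprime) (auto intro: primes_coprime squarefree_prime)

lemma squarefree_dvd_kernel: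
  assumes "squarefree c" "c dvd n" "n > 0"
  shows "c dvd squarefree_kernel n"
proof -
  have "c > 0" using assms by (auto intro: Nat.gr0I)
  have "c = (\<Prod>p\<in>prime_factors c. p ^ multiplicity p c)"
    using \<open>c > 0\<close> by (simp add: prod_prime_factors)
  also have "\<dots> = \<Prod>(prime_factors c)"
    using assms(1) \<open>c > 0\<close> by (intro prod.cong) (auto simp: squarefree_factorial_semiring')
  also have "\<dots> dvd \<Prod>(prime_factors n)"
    using assms by (intro prod_dvd_prod_subset dvd_prime_factors) auto
  finally show ?thesis by (simp add: squarefree_kernel_def)
qed

text \<open>
  The kernel is squarefree, so it can absorb only one of the two factors \<open>p\<close> of \<open>n\<close>; the other one
  survives in the quotient.
\<close>

lemma prime_le_largest_prime_factor_cofactor: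
  assumes "prime p" "p ^ 2 dvd n" "n > 0"
  shows "p \<le> largest_prime_factor (n div squarefree_kernel n)"
proof -
  define m where "m = n div squarefree_kernel n"
  have n: "n = squarefree_kernel n * m"
    using squarefree_kernel_dvd by (simp add: m_def)
  have "p dvd m"
  proof (rule ccontr)
    assume "\<not> p dvd m"
    then have "coprime (p ^ 2) m" using assms(1) by (simp add: prime_imp_coprime)
    then have "p ^ 2 dvd squarefree_kernel n"
      using assms(2) n by (metis coprime_dvd_mult_left_iff)
    then have "p dvd 1" using squarefreeD squarefree_squarefree_kernel by blast
    then show False using assms(1) by auto
  qed
  moreover have "m > 0" using n assms(3) by (metis gr0I mult_0_right)
  ultimately have "p \<in> prime_factors m" using assms(1) by (auto simp: prime_factors_dvd)
  then show ?thesis unfolding m_def[symmetric] largest_prime_factor_def by auto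
qed

section \<open>Powerful divisors\<close>

text \<open>
  Write \<open>n = t * s\<^sup>2\<close> with \<open>t\<close> squarefree. The primes of \<open>t\<close> that also divide \<open>s\<close> occur in \<open>n\<close> to
  an odd power that is at least \<open>3\<close>; they make up \<open>b = gcd s t\<close>, and the primes that are left over in
  \<open>c = t / b\<close> divide the kernel.
\<close>

lemma powerful_divisor_with_cofactor_le_kernel:
  fixes n :: nat
  assumes "n > 0"
  obtains a b c where "a > 0" "b > 0" "n = a ^ 2 * b ^ 3 * c" "c \<le> squarefree_kernel n"
proof -
  define s t where "s = square_part n" and "t = squarefree_part n"
  have n: "n = t * s ^ 2" unfolding s_def t_def by (rule squarefree_decompose)
  define b where "b = gcd s t"
  obtain a c where a: "s = b * a" and c: "t = b * c"
    unfolding b_def by (meson dvdE gcd_dvd1 gcd_dvd2)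
  have "squarefree t" by (auto simp: t_def)
  then have "squarefree c" unfolding c by (rule squarefree_multD)
  have eq: "n = a ^ 2 * b ^ 3 * c"
    unfolding n a c by (simp add: power2_eq_square power3_eq_cube)
  have "c dvd squarefree_kernel n"
    using \<open>squarefree c\<close> assms by (intro squarefree_dvd_kernel) (auto simp: eq)
  then have "c \<le> squarefree_kernel n" by (rule dvd_imp_le) (rule squarefree_kernel_pos)
  moreover have "a > 0" "b > 0" using eq assms by (auto intro!: Nat.gr0I)
  ultimately show ?thesis using eq that by blast
qed

text \<open>
  Let \<open>d\<close> be the least powerful divisor of \<open>n\<close> with \<open>d \<ge> D\<close>. Split \<open>d\<close> as a product of two smaller
  powerful numbers; by minimality both are below \<open>D\<close>, so \<open>d < D\<^sup>2\<close>. With a prime \<open>p\<close> dividing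
  \<open>a\<close> one splits off \<open>p\<^sup>2\<close>, and if \<open>a = 1\<close> one splits off \<open>p\<^sup>3\<close> for a prime \<open>p\<close> dividing \<open>b\<close>. The
  splitting fails only for \<open>d = 1\<close>, \<open>d = p\<^sup>2\<close> and \<open>d = p\<^sup>3\<close>. The first is at most \<open>D\<^sup>2\<close> as
  \<open>D \<ge> 1\<close>, and the last is harmless too: then \<open>p\<^sup>2 < D\<close> by minimality, hence
  \<open>d = p\<^sup>2 * p < D\<^sup>2\<close>.
\<close>

lemma powerful_divisor_or_prime_square:
  fixes D :: real and n a b :: nat
  assumes "a > 0" "b > 0" "a ^ 2 * b ^ 3 dvd n" "D \<le> real (a ^ 2 * b ^ 3)" "D \<ge> 1"
  shows "(\<exists>a b. a > 0 \<and> b > 0 \<and> a ^ 2 * b ^ 3 dvd n \<and> D \<le> real (a ^ 2 * b ^ 3) \<and>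
             real (a ^ 2 * b ^ 3) \<le> D ^ 2) \<or>
         (\<exists>p. prime p \<and> p ^ 2 dvd n \<and> D \<le> real (p ^ 2))"
proof -
  define P where "P d \<longleftrightarrow> (\<exists>a b. a > 0 \<and> b > 0 \<and> d = a ^ 2 * b ^ 3) \<and> d dvd n \<and> D \<le> real d"
    for d :: nat
  define d where "d = (LEAST d. P d)"
  have "P (a ^ 2 * b ^ 3)" using assms unfolding P_def by blast
  then have "P d" unfolding d_def by (rule LeastI)
  have min: "real d' < D"
    if "d' = a' ^ 2 * b' ^ 3" "a' > 0" "b' > 0" "d' dvd d" "d' \<noteq> d" for d' a' b'
  proof (rule ccontr)
    assume "\<not> real d' < D"
    then have "P d'" using that \<open>P d\<close> unfolding P_def by (auto intro: dvd_trans)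
    then have "d \<le> d'" unfolding d_def by (rule Least_le)
    moreover have "d' \<le> d" using that \<open>P d\<close> by (intro dvd_imp_le) (auto simp: P_def)
    ultimately show False using that by simp
  qed
  have small: ?thesis if "real d \<le> D ^ 2"
    using that \<open>P d\<close> unfolding P_def by blast
  obtain a b where ab: "a > 0" "b > 0" "d = a ^ 2 * b ^ 3" using \<open>P d\<close> by (auto simp: P_def)
  have D2: "D \<le> D ^ 2" using assms(5) by (simp add: power2_eq_square)
  consider p where "prime p" "p dvd a" | p where "a = 1" "prime p" "p dvd b" | "a = 1" "b = 1"
    using prime_factor_nat by metis
  then show ?thesis
  proof cases
    case (1 p)
    then obtain a' where a: "a = p * a'" by blast
    have "a' > 0" "p > 1" using a ab(1) prime_gt_1_nat[OF 1(1)] by auto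
    have d: "d = p ^ 2 * (a' ^ 2 * b ^ 3)" unfolding ab a by (simp add: power_mult_distrib)
    show ?thesis
    proof (cases "d = p ^ 2")
      case True
      then show ?thesis using 1 \<open>P d\<close> by (auto simp: P_def)
    next
      case False
      have "real (a' ^ 2 * b ^ 3) < D"
      proof (rule min[OF refl \<open>a' > 0\<close> \<open>b > 0\<close>])
        have "1 < p ^ 2" using \<open>p > 1\<close> by (intro one_less_power) auto
        then show "a' ^ 2 * b ^ 3 \<noteq> d" unfolding d using \<open>a' > 0\<close> \<open>b > 0\<close> by auto
      qed (simp add: d)
      moreover have "real (p ^ 2) < D"
        by (rule min[of _ p 1]) (use d False \<open>p > 1\<close> in auto)
      ultimately have "real d \<le> D * D"
        unfolding d of_nat_mult[of "p ^ 2"] using assms(5) by (intro mult_mono) auto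
      then show ?thesis using small by (simp add: power2_eq_square)
    qed
  next
    case (2 p)
    then obtain b' where b: "b = p * b'" by blast
    have "b' > 0" "p > 1" using b ab(2) prime_gt_1_nat[OF 2(2)] by auto
    have d: "d = p ^ 2 * (p * b' ^ 3)" unfolding ab b 2
      by (simp add: power_mult_distrib power2_eq_square power3_eq_cube)
    have d': "d = p ^ 3 * b' ^ 3" unfolding d by (simp add: power2_eq_square power3_eq_cube)
    have "1 < p * b' ^ 3"
      using \<open>b' > 0\<close> \<open>p > 1\<close> by (intro less_le_trans[of 1 p "p * b' ^ 3"]) auto
    then have p2: "real (p ^ 2) < D"
      by (intro min[of _ p 1]) (use d \<open>p > 1\<close> in auto)
    have "real d \<le> D * D"
    proof (cases "d = p ^ 3")
      case True
      have "real p \<le> real (p ^ 2)" using \<open>p > 1\<close> by (simp add: power2_eq_square)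
      then have "real (p ^ 2) * real p \<le> D * D"
        using p2 assms(5) by (intro mult_mono order_less_imp_le[OF p2]) linarith+
      then show ?thesis using True by (simp add: power2_eq_square power3_eq_cube)
    next
      case False
      have "real (p ^ 3) < D"
        by (rule min[of _ 1 p, OF _ _ _ _ not_sym[OF False]]) (use d' \<open>p > 1\<close> in auto)
      moreover have "real (b' ^ 3) < D"
      proof (rule min[of _ 1 b'])
        have "1 < p ^ 3" using \<open>p > 1\<close> by (intro one_less_power) auto
        then show "b' ^ 3 \<noteq> d" unfolding d' using \<open>b' > 0\<close> by auto
      qed (use d' \<open>b' > 0\<close> in auto)
      ultimately have "real (p ^ 3) * real (b' ^ 3) \<le> D * D"
        using assms(5) by (intro mult_mono) auto
      then show ?thesis using d' by simp
    qed
    then show ?thesis using small by (simp add: power2_eq_square)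
  next
    case 3
    then have "real d \<le> D ^ 2" using ab D2 assms(5) by simp
    then show ?thesis by (rule small)
  qed
qed

section \<open>Counting in short intervals\<close>

lemma card_multiples_le:
  fixes x y :: real and d :: nat
  assumes "d > 0" "x \<ge> 0" "y \<ge> 0"
  shows "real (card {n. x < real n \<and> real n \<le> x + y \<and> d dvd n}) \<le> y / d + 1"
proof -
  let ?S = "{n. x < real n \<and> real n \<le> x + y \<and> d dvd n}"
  have "?S \<subseteq> (\<lambda>i. d * nat i) ` {\<lfloor>x / d\<rfloor><..\<lfloor>(x + y) / d\<rfloor>}"
  proof
    fix n assume n: "n \<in> ?S"
    then obtain m where m: "n = d * m" by auto
    have "x / d < real m" "real m \<le> (x + y) / d"
      using n assms by (auto simp: m field_simps)
    then have "int m \<in> {\<lfloor>x / d\<rfloor><..\<lfloor>(x + y) / d\<rfloor>}"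
      by (auto simp: floor_less_iff le_floor_iff)
    then show "n \<in> (\<lambda>i. d * nat i) ` {\<lfloor>x / d\<rfloor><..\<lfloor>(x + y) / d\<rfloor>}"
      by (intro image_eqI[of _ _ "int m"]) (auto simp: m)
  qed
  then have "card ?S \<le> card {\<lfloor>x / d\<rfloor><..\<lfloor>(x + y) / d\<rfloor>}"
    by (rule surj_card_le[rotated]) simp
  also have "real \<dots> \<le> y / d + 1"
  proof -
    have "(x + y) / d = x / d + y / d" "y / d \<ge> 0" using assms by (auto simp: add_divide_distrib)
    moreover from this have "\<lfloor>x / d\<rfloor> \<le> \<lfloor>(x + y) / d\<rfloor>" by (intro floor_mono) simp
    ultimately show ?thesis by simp linarith
  qed
  finally show ?thesis by simp
qed

text \<open>
  Telescoping with \<open>1 / a\<^sup>2 \<le> 2 * (1 / a - 1 / (a + 1))\<close>, where the factor \<open>2\<close> makes the estimate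
  hold from \<open>a = 1\<close> on and the final bound hold for every positive \<open>A\<close>, including \<open>A < 1\<close>.
\<close>

lemma sum_inverse_squares_tail_le:
  fixes A :: real
  assumes "A > 0"
  shows "(\<Sum>a | 0 < a \<and> a \<le> N \<and> A \<le> real a. 1 / real a ^ 2) \<le> 2 / A"
proof -
  define M where "M = max 1 (nat \<lceil>A\<rceil>)"
  have M: "M \<ge> 1" "A \<le> real M" by (auto simp: M_def le_max_iff_disj real_nat_ceiling_ge of_nat_max)
  have set: "{a. 0 < a \<and> a \<le> N \<and> A \<le> real a} = {M..N}"
    by (auto simp: M_def)
  show ?thesis
  proof (cases "M \<le> N")
    case True
    have "(\<Sum>a\<in>{M..N}. 1 / real a ^ 2) \<le> (\<Sum>a\<in>{M..N}. 2 * (1 / real a - 1 / real (Suc a)))"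
    proof (rule sum_mono)
      fix a assume "a \<in> {M..N}"
      then have "real a \<ge> 1" using M by simp
      then show "1 / real a ^ 2 \<le> 2 * (1 / real a - 1 / real (Suc a))"
        by (simp add: divide_simps power2_eq_square)
    qed
    also have "\<dots> = 2 * (1 / real M - 1 / real (Suc N))"
      using True sum_Suc_diff[of M N "\<lambda>i. - (2 / real i)"] by simp
    also have "\<dots> \<le> 2 / real M" by simp
    also have "\<dots> \<le> 2 / A" using M assms by (intro divide_left_mono) auto
    finally show ?thesis unfolding set .
  next
    case False
    then have "{M..N} = {}" by simp
    then show ?thesis unfolding set using assms by simp
  qed
qed

text \<open>
  For fixed \<open>b\<close> the condition on \<open>a\<close> reads \<open>a \<ge> D powr (1/2) / b powr (3/2)\<close>, so the inner sum over
  \<open>a\<close> is at most \<open>2 * D powr (-1/2) * b powr (3/2)\<close>. After division by \<open>b\<^sup>3\<close> the sum over \<open>b\<close>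
  still converges.
\<close>

lemma sum_inverse_powerful_tail_le:
  fixes D :: real
  assumes "D > 0"
  shows "(\<Sum>(a, b) | a \<in> {1..N} \<and> b \<in> {1..N} \<and> D \<le> real (a ^ 2 * b ^ 3). 1 / real (a ^ 2 * b ^ 3))
    \<le> 2 * (\<Sum>b. real b powr (-3/2)) * D powr (-1/2)"
proof -
  let ?A = "\<lambda>b. {a. 0 < a \<and> a \<le> N \<and> D powr (1/2) / real b powr (3/2) \<le> real a}"
  have summable: "summable (\<lambda>b. real b powr (-3/2))"
    by (subst summable_real_powr_iff) simp
  have iff: "D \<le> real (a ^ 2 * b ^ 3) \<longleftrightarrow> D powr (1/2) / real b powr (3/2) \<le> real a"
    if "a > 0" "b > 0" for a b :: nat
  proof -
    have "D \<le> real (a ^ 2 * b ^ 3) \<longleftrightarrow> D powr (1/2) \<le> real (a ^ 2 * b ^ 3) powr (1/2)"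
      using assms powr_mono2[of "1/2" D "real (a ^ 2 * b ^ 3)"]
        powr_less_mono2[of "1/2" "real (a ^ 2 * b ^ 3)" D]
      by (auto simp: not_le[symmetric] simp del: of_nat_mult of_nat_power)
    also have "real (a ^ 2 * b ^ 3) powr (1/2) = (real a powr 2 * real b powr 3) powr (1/2)"
      using that by simp
    also have "\<dots> = real a * real b powr (3/2)"
      using that by (simp add: powr_mult powr_powr del: powr_numeral)
    finally show ?thesis using that by (simp add: field_simps)
  qed
  have "(\<Sum>(a, b) | a \<in> {1..N} \<and> b \<in> {1..N} \<and> D \<le> real (a ^ 2 * b ^ 3). 1 / real (a ^ 2 * b ^ 3))
    = (\<Sum>(b, a)\<in>Sigma {1..N} ?A. 1 / real (a ^ 2 * b ^ 3))"
    by (rule sum.reindex_bij_witness[of _ prod.swap prod.swap]) (auto simp: iff[symmetric] Suc_le_eq)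
  also have "\<dots> = (\<Sum>b=1..N. \<Sum>a\<in>?A b. 1 / real (a ^ 2 * b ^ 3))"
    by (subst sum.Sigma) auto
  also have "\<dots> \<le> (\<Sum>b=1..N. 2 * D powr (-1/2) * real b powr (-3/2))"
  proof (rule sum_mono)
    fix b assume "b \<in> {1..N}"
    then have b: "real b > 0" by simp
    have "(\<Sum>a\<in>?A b. 1 / real (a ^ 2 * b ^ 3)) = (\<Sum>a\<in>?A b. 1 / real a ^ 2) / real b ^ 3"
      by (simp add: sum_divide_distrib)
    also have "\<dots> \<le> 2 / (D powr (1/2) / real b powr (3/2)) / real b ^ 3"
      using b assms by (intro divide_right_mono sum_inverse_squares_tail_le) auto
    also have "\<dots> = 2 * D powr (-1/2) * (real b powr (3/2) / real b powr 3)"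
      using b by (simp add: powr_minus field_simps)
    also have "real b powr (3/2) / real b powr 3 = real b powr (-3/2)"
      by (subst powr_diff[symmetric]) simp
    finally show "(\<Sum>a\<in>?A b. 1 / real (a ^ 2 * b ^ 3)) \<le> 2 * D powr (-1/2) * real b powr (-3/2)" .
  qed
  also have "\<dots> = 2 * D powr (-1/2) * (\<Sum>b=1..N. real b powr (-3/2))"
    by (simp add: sum_distrib_left)
  also have "\<dots> \<le> 2 * D powr (-1/2) * (\<Sum>b. real b powr (-3/2))"
    by (intro mult_left_mono sum_le_suminf[OF summable]) auto
  finally show ?thesis by (simp add: mult_ac)
qed

lemma card_powerful_divisor_le:
  fixes x y D :: real
  assumes "x \<ge> 0" "y \<ge> 0" "D > 0"
  shows "real (card {n. x < real n \<and> real n \<le> x + y \<and> (\<exists>a b. a > 0 \<and> b > 0 \<and> a ^ 2 * b ^ 3 dvd n \<and>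
      D \<le> real (a ^ 2 * b ^ 3) \<and> real (a ^ 2 * b ^ 3) \<le> y)})
    \<le> 4 * (\<Sum>b. real b powr (-3/2)) * y * D powr (-1/2)"
    (is "real (card ?S) \<le> _")
proof -
  define N where "N = nat \<lfloor>y\<rfloor>"
  let ?I = "{(a, b). a \<in> {1..N} \<and> b \<in> {1..N} \<and> D \<le> real (a ^ 2 * b ^ 3)}"
  let ?J = "{(a, b) \<in> ?I. real (a ^ 2 * b ^ 3) \<le> y}"
  let ?T = "\<lambda>(a, b). {n. x < real n \<and> real n \<le> x + y \<and> a ^ 2 * b ^ 3 dvd n}"
  have "finite {n. x < real n \<and> real n \<le> x + y}"
    by (rule finite_subset[of _ "{..nat \<lfloor>x + y\<rfloor>}"]) (auto simp: le_nat_floor)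
  then have finT: "finite (?T i)" for i by (rule rev_finite_subset) (auto split: prod.splits)
  have finI: "finite ?I" by (rule finite_subset[of _ "{1..N} \<times> {1..N}"]) auto
  have finJ: "finite ?J" using finI by (rule rev_finite_subset) auto
  have "?S \<subseteq> (\<Union>i\<in>?J. ?T i)"
  proof
    fix n assume "n \<in> ?S"
    then obtain a b where n: "x < real n" "real n \<le> x + y" and ab: "a > 0" "b > 0"
      "a ^ 2 * b ^ 3 dvd n" "D \<le> real (a ^ 2 * b ^ 3)" "real (a ^ 2 * b ^ 3) \<le> y" by blast
    have "a dvd a ^ 2 * b ^ 3" "b dvd a ^ 2 * b ^ 3"
      by (auto simp: power2_eq_square power3_eq_cube)
    then have "a \<le> a ^ 2 * b ^ 3" "b \<le> a ^ 2 * b ^ 3" using ab by (auto intro!: dvd_imp_le)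
    moreover have "a ^ 2 * b ^ 3 \<le> N" unfolding N_def using ab(5) by (rule le_nat_floor)
    ultimately have "a \<le> N" "b \<le> N" by linarith+
    then have "(a, b) \<in> ?J" using ab by auto
    then show "n \<in> (\<Union>i\<in>?J. ?T i)" using n ab by (intro UN_I[of "(a, b)"]) auto
  qed
  then have "card ?S \<le> card (\<Union>i\<in>?J. ?T i)" using finJ finT by (intro card_mono) auto
  also have "\<dots> \<le> (\<Sum>i\<in>?J. card (?T i))" using finJ by (rule card_UN_le)
  also have "real \<dots> \<le> (\<Sum>(a, b)\<in>?J. 2 * y * (1 / real (a ^ 2 * b ^ 3)))"
    unfolding of_nat_sum
  proof (rule sum_mono)
    fix i assume "i \<in> ?J"
    then obtain a b where i: "i = (a, b)" "a > 0" "b > 0" "real (a ^ 2 * b ^ 3) \<le> y" by auto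
    let ?d = "a ^ 2 * b ^ 3"
    have "real (card (?T i)) \<le> y / real ?d + 1"
      using i card_multiples_le[of ?d x y] assms by simp
    \<comment> \<open>As \<open>d \<le> y\<close>, the rounding error is dominated by the main term.\<close>
    also have "1 \<le> y / real ?d" using i by (subst le_divide_eq) auto
    finally show "real (card (?T i)) \<le> (case i of (a, b) \<Rightarrow> 2 * y * (1 / real (a ^ 2 * b ^ 3)))"
      by (simp add: i)
  qed
  also have "\<dots> \<le> (\<Sum>(a, b)\<in>?I. 2 * y * (1 / real (a ^ 2 * b ^ 3)))"
    using finI assms by (intro sum_mono2) auto
  also have "\<dots> = 2 * y * (\<Sum>(a, b)\<in>?I. 1 / real (a ^ 2 * b ^ 3))"
    by (simp add: sum_distrib_left case_prod_unfold)
  also have "\<dots> \<le> 2 * y * (2 * (\<Sum>b. real b powr (-3/2)) * D powr (-1/2))"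
    using sum_inverse_powerful_tail_le[OF assms(3), of N] assms(2) by (intro mult_left_mono) auto
  finally show ?thesis by (simp add: mult_ac)
qed

lemma card_large_prime_square_le:
  fixes x y z :: real
  assumes "x \<ge> 0" "y \<ge> 1" "z \<ge> 0"
  shows "real (card {n. x < real n \<and> real n \<le> x + y \<and>
      (\<exists>p. prime p \<and> p ^ 2 dvd n \<and> y < real p ^ 2 \<and> real p \<le> z)}) \<le> 6 * ln 4 * z / ln (y + 1)"
    (is "real (card ?S) \<le> _")
proof -
  let ?P = "{p::nat. prime p \<and> y < real p ^ 2 \<and> real p \<le> z}"
  let ?T = "\<lambda>p. {n. x < real n \<and> real n \<le> x + y \<and> p ^ 2 dvd n}"
  have finP: "finite ?P"
    by (rule finite_subset[of _ "{..nat \<lfloor>z\<rfloor>}"]) (auto simp: le_nat_floor)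
  have "finite {n. x < real n \<and> real n \<le> x + y}"
    by (rule finite_subset[of _ "{..nat \<lfloor>x + y\<rfloor>}"]) (auto simp: le_nat_floor)
  then have finT: "finite (?T p)" for p by (rule rev_finite_subset) auto
  have "card ?S \<le> card (\<Union>p\<in>?P. ?T p)" using finP finT by (intro card_mono) auto
  also have "\<dots> \<le> (\<Sum>p\<in>?P. card (?T p))" using finP by (rule card_UN_le)
  also have "real \<dots> \<le> (\<Sum>p\<in>?P. 2)"
    unfolding of_nat_sum
  proof (rule sum_mono)
    fix p assume "p \<in> ?P"
    then have p: "p > 0" "y < real p ^ 2" by (auto simp: prime_gt_0_nat)
    have "real (card (?T p)) \<le> y / real (p ^ 2) + 1"
      using p card_multiples_le[of "p ^ 2" x y] assms by simp
    also have "y / real (p ^ 2) \<le> 1" using p by simp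
    finally show "real (card (?T p)) \<le> 2" by simp
  qed
  finally have "real (card ?S) * ln (y + 1) \<le> 2 * real (card ?P) * ln (y + 1)"
    using assms by (intro mult_right_mono) auto
  also have "\<dots> \<le> 6 * ln 4 * z" using card_primes_above_sqrt_le[OF assms(2,3)] by (simp add: mult_ac)
  finally show ?thesis using assms by (simp add: le_divide_eq)
qed

section \<open>Powered integers in short intervals\<close>

theorem theorem1:
  fixes k :: real
  assumes "k > 1"
  shows "\<exists>C>0. \<forall>\<delta> x y :: real. 0 \<le> \<delta> \<longrightarrow> \<delta> < 1 \<longrightarrow> 1 \<le> y \<longrightarrow> y \<le> x \<longrightarrow>
    real (card {n :: nat. x < real n \<and> real n \<le> x + y \<and> k_powered k n \<and>
        real (largest_prime_factor (n div squarefree_kernel n)) \<le> y powr (1 - \<delta>)})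
      \<le> C * (y powr ((3 * k + 1) / (4 * k)) + y powr (1 - \<delta>) / ln (y + 1))"
proof -
  define Z :: real where "Z = (\<Sum>b. real b powr (-3/2))"
  have "Z \<ge> 0" unfolding Z_def by (intro suminf_nonneg) (auto simp: summable_real_powr_iff)
  define C where "C = 4 * Z + 6 * ln 4"
  have "(0::real) < ln 4" by simp
  then have "C > 0" using \<open>Z \<ge> 0\<close> unfolding C_def by linarith
  show ?thesis
  proof (intro exI[of _ C] conjI allI impI \<open>C > 0\<close>)
    fix \<delta> x y :: real
    assume "1 \<le> y" "y \<le> x"
    define z where "z = y powr (1 - \<delta>)"
    define D where "D = y powr ((1 - 1 / k) / 2)"
    let ?S = "{n. x < real n \<and> real n \<le> x + y \<and> k_powered k n \<and>
        real (largest_prime_factor (n div squarefree_kernel n)) \<le> z}"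
    let ?S1 = "{n. x < real n \<and> real n \<le> x + y \<and> (\<exists>a b. a > 0 \<and> b > 0 \<and> a ^ 2 * b ^ 3 dvd n \<and>
      D \<le> real (a ^ 2 * b ^ 3) \<and> real (a ^ 2 * b ^ 3) \<le> y)}"
    let ?S2 = "{n. x < real n \<and> real n \<le> x + y \<and>
      (\<exists>p. prime p \<and> p ^ 2 dvd n \<and> y < real p ^ 2 \<and> real p \<le> z)}"
    have k: "0 \<le> 1 - 1 / k" "1 - 1 / k \<le> 1" using assms by auto
    have D1: "D \<ge> 1" unfolding D_def using \<open>1 \<le> y\<close> k by (intro ge_one_powr_ge_zero) auto
    have D2: "D ^ 2 = y powr (1 - 1 / k)"
    proof -
      have "D ^ 2 = D powr 2" using D1 by simp
      also have "\<dots> = y powr ((1 - 1 / k) / 2 * 2)" unfolding D_def by (rule powr_powr)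
      also have "(1 - 1 / k) / 2 * 2 = 1 - 1 / k" by (metis nonzero_eq_divide_eq zero_neq_numeral)
      finally show ?thesis .
    qed
    have D3: "D ^ 2 \<le> y" unfolding D2 using powr_mono[of "1 - 1 / k" 1 y] \<open>1 \<le> y\<close> k by simp
    have "n \<in> ?S1 \<union> ?S2" if "n \<in> ?S" for n
    proof -
      have n: "x < real n" "real n \<le> x + y" "n > 0" "real (squarefree_kernel n) \<le> real n powr (1 / k)"
        "real (largest_prime_factor (n div squarefree_kernel n)) \<le> z"
        using that by (auto simp: k_powered_def)
      obtain a b c where abc: "a > 0" "b > 0" "n = a ^ 2 * b ^ 3 * c" "c \<le> squarefree_kernel n"
        using powerful_divisor_with_cofactor_le_kernel[OF n(3)] .
      have "D \<le> D ^ 2" using D1 by (simp add: power2_eq_square)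
      also have "\<dots> \<le> real n powr (1 - 1 / k)"
        unfolding D2 using \<open>1 \<le> y\<close> \<open>y \<le> x\<close> n k by (intro powr_mono2) auto
      also have "\<dots> \<le> real (a ^ 2 * b ^ 3)"
      proof -
        have "real n powr (1 - 1 / k) * real n powr (1 / k) = real n"
          using n(3) by (simp add: powr_add[symmetric])
        also have "\<dots> = real (a ^ 2 * b ^ 3) * real c" using abc(3) by (metis of_nat_mult)
        also have "\<dots> \<le> real (a ^ 2 * b ^ 3) * real n powr (1 / k)"
          using abc(4) n(4) by (intro mult_left_mono) auto
        finally show ?thesis using n(3) by (subst (asm) mult_le_cancel_right) auto
      qed
      finally have "D \<le> real (a ^ 2 * b ^ 3)" .
      moreover have "a ^ 2 * b ^ 3 dvd n" using abc(3) by simp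
      ultimately consider (window) a b where "a > 0" "b > 0" "a ^ 2 * b ^ 3 dvd n"
          "D \<le> real (a ^ 2 * b ^ 3)" "real (a ^ 2 * b ^ 3) \<le> D ^ 2"
        | (square) p where "prime p" "p ^ 2 dvd n" "D \<le> real (p ^ 2)"
        using powerful_divisor_or_prime_square[OF abc(1,2) _ _ D1, of n] by blast
      then show ?thesis
      \<comment> \<open>A prime square that is at most \<open>y\<close> also lies between \<open>D\<close> and \<open>y\<close>, so it counts for \<open>?S1\<close>.\<close>
      proof cases
        case (window a b)
        then have "real (a ^ 2 * b ^ 3) \<le> y" using D3 by linarith
        with window n show ?thesis by blast
      next
        case (square p)
        have "real p \<le> z"
          using prime_le_largest_prime_factor_cofactor[OF square(1,2) n(3)] n(5) by linarith
        show ?thesis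
        proof (cases "y < real p ^ 2")
          case True
          then show ?thesis using square n \<open>real p \<le> z\<close> by auto
        next
          case False
          then have "p > 0 \<and> (1::nat) > 0 \<and> p ^ 2 * 1 ^ 3 dvd n \<and> D \<le> real (p ^ 2 * 1 ^ 3) \<and>
            real (p ^ 2 * 1 ^ 3) \<le> y"
            using square by (auto simp: prime_gt_0_nat)
          then show ?thesis using n by blast
        qed
      qed
    qed
    then have "?S \<subseteq> ?S1 \<union> ?S2" by (rule subsetI)
    moreover have "finite (?S1 \<union> ?S2)"
      by (rule finite_subset[of _ "{..nat \<lfloor>x + y\<rfloor>}"]) (auto simp: le_nat_floor)
    ultimately have "card ?S \<le> card (?S1 \<union> ?S2)" by (intro card_mono)
    also have "\<dots> \<le> card ?S1 + card ?S2" by (rule card_Un_le)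
    finally have "real (card ?S) \<le> real (card ?S1) + real (card ?S2)" by linarith
    also have "real (card ?S1) \<le> 4 * Z * y * D powr (-1/2)"
      unfolding Z_def using \<open>1 \<le> y\<close> \<open>y \<le> x\<close> D1 by (intro card_powerful_divisor_le) auto
    also have "\<dots> = 4 * Z * y powr ((3 * k + 1) / (4 * k))"
    proof -
      have "y * D powr (-1/2) = y powr (1 + (1 - 1 / k) / 2 * (-1/2))"
        unfolding powr_add using \<open>1 \<le> y\<close> by (simp add: D_def powr_powr)
      also have "1 + (1 - 1 / k) / 2 * (-1/2) = (3 * k + 1) / (4 * k)"
        using assms by (simp add: field_simps)
      finally show ?thesis by simp
    qed
    also have "real (card ?S2) \<le> 6 * ln 4 * z / ln (y + 1)"
      using \<open>1 \<le> y\<close> \<open>y \<le> x\<close> by (intro card_large_prime_square_le) (auto simp: z_def)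
    also have "4 * Z * y powr ((3 * k + 1) / (4 * k)) + 6 * ln 4 * z / ln (y + 1)
      \<le> C * y powr ((3 * k + 1) / (4 * k)) + C * (z / ln (y + 1))"
    proof (rule add_mono)
      show "4 * Z * y powr ((3 * k + 1) / (4 * k)) \<le> C * y powr ((3 * k + 1) / (4 * k))"
        by (rule mult_right_mono) (auto simp: C_def)
      have "6 * ln 4 * (z / ln (y + 1)) \<le> C * (z / ln (y + 1))"
        using \<open>1 \<le> y\<close> \<open>Z \<ge> 0\<close> by (intro mult_right_mono) (auto simp: C_def z_def)
      then show "6 * ln 4 * z / ln (y + 1) \<le> C * (z / ln (y + 1))" by simp
    qed
    finally show "real (card {n :: nat. x < real n \<and> real n \<le> x + y \<and> k_powered k n \<and>
        real (largest_prime_factor (n div squarefree_kernel n)) \<le> y powr (1 - \<delta>)})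
      \<le> C * (y powr ((3 * k + 1) / (4 * k)) + y powr (1 - \<delta>) / ln (y + 1))"
      unfolding z_def by (simp add: distrib_left)
  qed
qed

end
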